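(* For every integer $p\ge 2$, $$r\!\left(K_{n,n},K_{p,p},p^2-p+1\right)=\Omega\!\left(n^{2-\frac{2}{\lfloor p/2\rfloor}}\right).$$
   Context: For graphs $G,H$ and an integer $q$ with $2\le q\le |E(H)|$, an $(H,q)$-coloring of $G$ is an edge-coloring of $G$ in which every subgraph of $G$ isomorphic to $H$ receives at least $q$ distinct colors; $r(G,H,q)$ is the minimum number of colors needed for $G$ to have an $(H,q)$-coloring. $K_{n,n}$, $K_{p,p}$ denote complete bipartite graphs. Asymptotic notation refers to $n\to\infty$ with $p$ fixed. *)

theory Defs
  imports Complex_Main "HOL-Library.Landau_Symbols"
begin

record 'a graph =
  verts :: "'a set"
  edges :: "'a set set"

definition simple_graph :: "'a graph \<Rightarrow> bool" where
  "simple_graph G \<longleftrightarrow> (\<forall>e\<in>edges G. e \<subseteq> verts G \<and> card e = 2)"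

text \<open>Subgraphs need not be induced or spanning.\<close>

definition subgraph :: "'a graph \<Rightarrow> 'a graph \<Rightarrow> bool" where
  "subgraph S G \<longleftrightarrow> simple_graph S \<and> verts S \<subseteq> verts G \<and> edges S \<subseteq> edges G"

definition graph_iso :: "'a graph \<Rightarrow> 'b graph \<Rightarrow> bool" where
  "graph_iso G H \<longleftrightarrow>
     (\<exists>f. bij_betw f (verts G) (verts H) \<and> (\<lambda>e. f ` e) ` edges G = edges H)"

definition complete_bipartite :: "nat \<Rightarrow> nat \<Rightarrow> (nat + nat) graph" where
  "complete_bipartite m n =
     \<lparr>verts = {..<m} <+> {..<n}, edges = {{Inl i, Inr j} | i j. i < m \<and> j < n}\<rparr>"

definition Hq_coloring :: "'a graph \<Rightarrow> 'b graph \<Rightarrow> nat \<Rightarrow> ('a set \<Rightarrow> 'c) \<Rightarrow> bool" where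
  "Hq_coloring G H q c \<longleftrightarrow>
     (\<forall>S. subgraph S G \<and> graph_iso S H \<longrightarrow> q \<le> card (c ` edges S))"

text \<open>Meant for finite graphs \<open>G\<close> and \<open>2 \<le> q \<le> |E(H)|\<close>. A finite graph uses finitely many
  colors, so natural numbers suffice as colors; the minimum is then attained, see
  \<open>gen_ramsey_attained\<close> below.\<close>

definition gen_ramsey :: "'a graph \<Rightarrow> 'b graph \<Rightarrow> nat \<Rightarrow> nat" where
  "gen_ramsey G H q =
     (LEAST k. \<exists>c :: 'a set \<Rightarrow> nat. Hq_coloring G H q c \<and> card (c ` edges G) = k)"

lemma gen_ramsey_attained:
  assumes "finite (edges G)" "q \<le> card (edges H)"
  shows "\<exists>c :: 'a set \<Rightarrow> nat. Hq_coloring G H q c \<and> card (c ` edges G) = gen_ramsey G H q"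
proof -
  obtain c :: "'a set \<Rightarrow> nat" where c: "inj_on c (edges G)"
    using assms(1) finite_imp_inj_to_nat_seg by blast
  have "q \<le> card (c ` edges S)" if S: "subgraph S G" "graph_iso S H" for S
  proof -
    obtain f where f: "bij_betw f (verts S) (verts H)" "(\<lambda>e. f ` e) ` edges S = edges H"
      using S(2) by (auto simp: graph_iso_def)
    have sub: "edges S \<subseteq> edges G"
      using S(1) by (simp add: subgraph_def)
    have "card (edges H) \<le> card (edges S)"
      unfolding f(2)[symmetric]
      by (rule card_image_le) (rule finite_subset[OF sub assms(1)])
    also have "\<dots> = card (c ` edges S)"
      by (rule card_image[symmetric]) (rule inj_on_subset[OF c sub])
    finally show ?thesis using assms(2) by simp
  qed
  hence "Hq_coloring G H q c" by (simp add: Hq_coloring_def)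
  hence "\<exists>k. \<exists>c :: 'a set \<Rightarrow> nat. Hq_coloring G H q c \<and> card (c ` edges G) = k" by blast
  thus ?thesis unfolding gen_ramsey_def by (rule LeastI_ex)
qed

end

(* Let t = p div 2 and count |X| |Y| - #colors(X, Y) repeats for vertex sets X, Y. In a valid coloring no
   X, Y with at most p vertices each span p repeats. Discard the edges lying in monochromatic stars
   with p edges (two distinct vertices never both repeat a color on the same two edges of such a
   star, so these are few) and the edges of small color classes. The color energy graph has the
   pairs of vertices of either side as its vertices, and joins (a, b) to (x, y) when ax and by have
   the same color. By Cauchy-Schwarz it has at least of order n^4 / k edges on at most 2 n^2 vertices
   if k colors are used. If p >= 4 and k is a small multiple of n^(2 - 2/t), then some subgraph has more rainbow
   trails of length t from a fixed vertex than there are endpoints, even up to reordering of edges.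
   The symmetric difference of the edge sets of two such trails with a common endpoint has even
   degrees, at most 2t <= p edges and at most two edges of each color. It yields m repeats on at most
   m vertices per side for some m <= p, and m grows to p by adding edges of large color classes. *)

theory Submission
  imports Defs "HOL-Analysis.Convex"
begin

section \<open>Rainbow trails and even-degree subgraphs\<close>

text \<open>A vertex of degree below \<open>D\<close> can be deleted: it takes fewer than
  \<open>D\<close> edges with it, so the density hypothesis survives, and repeating this must
  stop.\<close>

lemma min_degree_subgraph:
  fixes ends :: "'e \<Rightarrow> 'v set"
  assumes "finite V" "finite E" "E \<noteq> {}" "\<And>e. e \<in> E \<Longrightarrow> ends e \<subseteq> V"
    and ne: "\<And>e. e \<in> E \<Longrightarrow> ends e \<noteq> {}"
    and "D * card V \<le> card E"
  obtains V' E' where "V' \<subseteq> V" "E' \<subseteq> E" "E' \<noteq> {}" "\<And>e. e \<in> E' \<Longrightarrow> ends e \<subseteq> V'"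
    "\<And>v. v \<in> V' \<Longrightarrow> D \<le> card {e\<in>E'. v \<in> ends e}"
  using assms
proof (induction "card V" arbitrary: V E thesis rule: less_induct)
  case less
  show ?case
  proof (cases "\<forall>v\<in>V. D \<le> card {e\<in>E. v \<in> ends e}")
    case True
    thus ?thesis by (intro less.prems(1)[of V E] less.prems(4,5)) simp_all
  next
    case False
    then obtain v where v: "v \<in> V" "card {e\<in>E. v \<in> ends e} < D" by auto
    define E1 where "E1 = {e\<in>E. v \<notin> ends e}"
    have "E = E1 \<union> {e\<in>E. v \<in> ends e}" "E1 \<inter> {e\<in>E. v \<in> ends e} = {}" by (auto simp: E1_def)
    hence "card E = card E1 + card {e\<in>E. v \<in> ends e}"
      using less.prems(3) by (metis (no_types, lifting) card_Un_disjoint finite_Un)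
    moreover have cV: "card V = Suc (card (V - {v}))"
      using v(1) less.prems(2) by (simp only: card_Suc_Diff1)
    \<comment> \<open>The strict inequality matters: it also shows that some edge is left after the
      deletion.\<close>
    ultimately have "D * card (V - {v}) < card E1"
      using less.prems(7) v(2) by auto
    hence E1: "D * card (V - {v}) \<le> card E1" "E1 \<noteq> {}" by auto
    have sub: "E1 \<subseteq> E" by (auto simp: E1_def)
    have ends1: "ends e \<subseteq> V - {v}" if "e \<in> E1" for e
      using less.prems(5)[of e] that by (auto simp: E1_def)
    have ne1: "ends e \<noteq> {}" if "e \<in> E1" for e
      using less.prems(6)[of e] that sub by auto
    have fin1: "finite (V - {v})" "finite E1"
      using less.prems(2,3) sub by (auto intro: finite_subset)
    obtain V' E' where *: "V' \<subseteq> V - {v}" "E' \<subseteq> E1" "E' \<noteq> {}" "\<And>e. e \<in> E' \<Longrightarrow> ends e \<subseteq> V'"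
      "\<And>v. v \<in> V' \<Longrightarrow> D \<le> card {e\<in>E'. v \<in> ends e}"
      by (rule less.hyps[OF _ _ fin1 E1(2) ends1 ne1 E1(1)]) (use cV in auto)
    show ?thesis
      by (rule less.prems(1)[of V' E']) (use * sub in auto)
  qed
qed

lemma even_card_symmetric_difference:
  assumes "finite A" "finite B"
  shows "even (card ((A - B) \<union> (B - A))) \<longleftrightarrow> even (card A + card B)"
proof -
  have "card ((A - B) \<union> (B - A)) = card (A - B) + card (B - A)"
    using assms by (intro card_Un_disjoint) auto
  moreover have "card A = card (A - B) + card (A \<inter> B)"
    using assms(1) by (metis add.commute card_Int_Diff)
  moreover have "card B = card (B - A) + card (A \<inter> B)"
    using assms(2) by (metis add.commute card_Int_Diff inf_commute)
  ultimately show ?thesis by presburger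
qed

lemma even_subgraph_few_colors:
  fixes ends :: "'e \<Rightarrow> 'v set" and \<chi> :: "'e \<Rightarrow> 'c"
  assumes fin: "finite V" "finite E" and ne: "E \<noteq> {}"
    and ends: "\<And>e. e \<in> E \<Longrightarrow> ends e \<subseteq> V" "\<And>e. e \<in> E \<Longrightarrow> card (ends e) = 2"
    and col: "\<And>v g. v \<in> V \<Longrightarrow> card {e\<in>E. v \<in> ends e \<and> \<chi> e = g} \<le> K"
    and many: "(t * K + t * b) * card V \<le> card E"
    and big: "card V < b ^ t"
  obtains F where "F \<subseteq> E" "F \<noteq> {}" "card F \<le> 2 * t"
    "\<And>v. even (card {e\<in>F. v \<in> ends e})" "\<And>g. card {e\<in>F. \<chi> e = g} \<le> 2"
proof -
  have ends_ne: "ends e \<noteq> {}" if "e \<in> E" for e using ends(2)[OF that] by auto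
  obtain V' E' where V': "V' \<subseteq> V" and E': "E' \<subseteq> E" "E' \<noteq> {}"
    and ends': "\<And>e. e \<in> E' \<Longrightarrow> ends e \<subseteq> V'"
    and deg: "\<And>v. v \<in> V' \<Longrightarrow> t * K + t * b \<le> card {e\<in>E'. v \<in> ends e}"
    by (rule min_degree_subgraph[of V E ends, OF fin ne ends(1) ends_ne many]) (assumption | rule that)+
  have fin': "finite V'" "finite E'" using V' E' fin finite_subset by auto
  obtain e0 where e0: "e0 \<in> E'" using E'(2) by auto
  hence "ends e0 \<noteq> {}" using ends(2) E'(1) by fastforce
  then obtain r where r: "r \<in> V'" using ends' e0 by auto
  \<comment> \<open>The pairs (edge set, endpoint) of rainbow trails from r, remembering only degree parities.\<close>
  define W where "W i = {(F, v). F \<subseteq> E' \<and> v \<in> V' \<and> card F = i \<and> inj_on \<chi> F \<and>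
    (\<forall>u. even (card {e\<in>F. u \<in> ends e} + of_bool (u = r) + of_bool (u = v)))}" for i
  have W_sub: "W i \<subseteq> Pow E' \<times> V'" for i by (auto simp: W_def)
  have finW: "finite (W i)" for i
    using W_sub by (rule finite_subset) (use fin' in auto)
  have finW1: "finite (fst x)" if "x \<in> W j" for x j
    using that by (intro finite_subset[OF _ fin'(2)]) (auto simp: W_def)
  define other where "other v e = the_elem (ends e - {v})" for v e
  have other: "ends e = {v, other v e} \<and> other v e \<noteq> v \<and> other (other v e) e = v"
    if e: "e \<in> E'" and v: "v \<in> ends e" for v e
  proof -
    have "card (ends e) = 2" using ends(2) E'(1) e by auto
    then obtain x y where "ends e = {x, y}" "x \<noteq> y" by (meson card_2_iff)
    then obtain w where w: "ends e = {v, w}" "w \<noteq> v" using v by auto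
    hence "ends e - {v} = {w}" "ends e - {w} = {v}" by auto
    thus ?thesis using w by (simp add: other_def)
  qed
  \<comment> \<open>The edges by which the trail \<open>F\<close> ending at \<open>v\<close> may be
    continued.\<close>
  define X where "X F v = {e\<in>E'. v \<in> ends e \<and> \<chi> e \<notin> \<chi> ` F}" for F v
  have step: "b * card (W i) \<le> card (W (Suc i))" if i: "i < t" for i
  proof -
    \<comment> \<open>The fewer than \<open>t\<close> colors of \<open>F\<close> block at most
      \<open>K\<close> edges at \<open>v\<close> each.\<close>
    have X_ge: "t * b \<le> card (X F v)" if Fv: "(F, v) \<in> W i" for F v
    proof -
      have F: "F \<subseteq> E'" "v \<in> V'" "card F = i" using Fv by (auto simp: W_def)
      have finF: "finite F" using F fin' finite_subset by auto
      have "{e\<in>E'. v \<in> ends e} \<subseteq> X F v \<union> (\<Union>g\<in>\<chi> ` F. {e\<in>E. v \<in> ends e \<and> \<chi> e = g})"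
        using E'(1) by (auto simp: X_def)
      hence "card {e\<in>E'. v \<in> ends e} \<le> card (X F v \<union> (\<Union>g\<in>\<chi> ` F. {e\<in>E. v \<in> ends e \<and> \<chi> e = g}))"
        by (rule card_mono[rotated]) (use fin fin' finF in \<open>auto simp: X_def\<close>)
      also have "\<dots> \<le> card (X F v) + card (\<Union>g\<in>\<chi> ` F. {e\<in>E. v \<in> ends e \<and> \<chi> e = g})"
        by (rule card_Un_le)
      also have "card (\<Union>g\<in>\<chi> ` F. {e\<in>E. v \<in> ends e \<and> \<chi> e = g})
          \<le> (\<Sum>g\<in>\<chi> ` F. card {e\<in>E. v \<in> ends e \<and> \<chi> e = g})"
        by (rule card_UN_le) (use finF in auto)
      also have "\<dots> \<le> (\<Sum>g\<in>\<chi> ` F. K)"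
        by (rule sum_mono) (use col F V' in auto)
      also have "\<dots> \<le> t * K"
        using card_image_le[OF finF, of \<chi>] F(3) i by simp
      finally show ?thesis using deg[OF F(2)] by linarith
    qed
    define T where "T = Sigma (W i) (\<lambda>(F, v). X F v)"
    \<comment> \<open>The new edge is kept as a mark on the extended set. This makes
      \<open>ext\<close> injective: removing the mark recovers \<open>F\<close>, and crossing it
      backwards recovers \<open>v\<close>. A set in \<open>W (Suc i)\<close> can be marked in
      \<open>Suc i\<close> ways.\<close>
    define ext where "ext = (\<lambda>((F, v), e). ((insert e F, other v e), e))"
    have finX: "finite (X F v)" for F v using fin' by (auto simp: X_def)
    have "card (W i) * (t * b) \<le> (\<Sum>(F, v)\<in>W i. card (X F v))"
      using sum_mono[of "W i" "\<lambda>_. t * b" "\<lambda>(F, v). card (X F v)"] X_ge by auto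
    also have "\<dots> = card T"
      unfolding T_def using finW finX by (subst card_SigmaI) (auto intro: sum.cong)
    also have "\<dots> \<le> card (Sigma (W (Suc i)) fst)"
    proof (rule card_inj_on_le)
      show "inj_on ext T"
      proof (rule inj_onI)
        fix x y assume xy: "x \<in> T" "y \<in> T" "ext x = ext y"
        obtain F v e F' v' e' where eq: "x = ((F, v), e)" "y = ((F', v'), e')" by (metis surj_pair)
        have "e' = e" and ins: "insert e F = insert e F'" and o: "other v e = other v' e"
          using xy(3) by (auto simp: ext_def eq)
        have e: "e \<in> X F v" "e \<in> X F' v'" using xy \<open>e' = e\<close> by (auto simp: T_def eq)
        hence "e \<notin> F" "e \<notin> F'" by (auto simp: X_def)
        hence "F = F'" using ins by (simp add: insert_ident)
        moreover have "v = v'"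
        proof -
          have "other (other v e) e = v" "other (other v' e) e = v'"
            using other[of e v] other[of e v'] e by (simp_all add: X_def)
          thus ?thesis using o by (metis (no_types))
        qed
        ultimately show "x = y" using \<open>e' = e\<close> eq by simp
      qed
      show "ext ` T \<subseteq> Sigma (W (Suc i)) fst"
      proof clarsimp
        fix F v e F' w e' assume T: "((F, v), e) \<in> T" and "((F', w), e') = ext ((F, v), e)"
        hence eq: "F' = insert e F" "w = other v e" "e' = e" by (auto simp: ext_def)
        have Fv: "F \<subseteq> E'" "v \<in> V'" "card F = i" "inj_on \<chi> F"
          and par: "\<And>u. even (card {e\<in>F. u \<in> ends e} + of_bool (u = r) + of_bool (u = v))"
          using T by (auto simp: T_def W_def)
        have e: "e \<in> E'" "v \<in> ends e" "\<chi> e \<notin> \<chi> ` F" using T by (auto simp: T_def X_def)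
        have finF: "finite F" using Fv fin' finite_subset by auto
        have eF: "e \<notin> F" using e by auto
        note o = other[OF e(1,2)]
        have "card F' = Suc i" using finF eF Fv eq by simp
        moreover have "inj_on \<chi> F'" using Fv(4) e(3) eF eq by simp
        \<comment> \<open>The edge \<open>e\<close> changes the degree parity at \<open>v\<close>
          and \<open>w\<close> only, which moves the endpoint from \<open>v\<close> to
          \<open>w\<close>.\<close>
        moreover have "even (card {e\<in>F'. u \<in> ends e} + of_bool (u = r) + of_bool (u = w))" for u
        proof -
          have "{e'\<in>F'. u \<in> ends e'} =
             (if u \<in> ends e then insert e {e'\<in>F. u \<in> ends e'} else {e'\<in>F. u \<in> ends e'})"
            by (auto simp: eq)
          hence "card {e'\<in>F'. u \<in> ends e'} = card {e'\<in>F. u \<in> ends e'} + of_bool (u \<in> ends e)"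
            using finF eF by simp
          moreover have "u \<in> ends e \<longleftrightarrow> u = v \<or> u = w" "w \<noteq> v"
            using o unfolding eq by blast+
          ultimately show ?thesis using par[of u] by (cases "u = v"; cases "u = w") simp_all
        qed
        moreover have "w \<in> V'" using ends'[OF e(1)] o unfolding eq by blast
        ultimately show "(F', w) \<in> W (Suc i) \<and> e' \<in> F'"
          using Fv(1) e(1) eq by (auto simp: W_def)
      qed
      show "finite (Sigma (W (Suc i)) fst)"
        by (intro finite_SigmaI finW finW1)
    qed
    also have "\<dots> = (\<Sum>x\<in>W (Suc i). card (fst x))"
      using finW finW1 by (intro card_SigmaI) auto
    also have "\<dots> = (\<Sum>x\<in>W (Suc i). Suc i)"
      by (rule sum.cong) (auto simp: W_def)
    also have "\<dots> = card (W (Suc i)) * Suc i" by simp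
    also have "\<dots> \<le> card (W (Suc i)) * t" using i by (intro mult_le_mono) auto
    finally have "t * (b * card (W i)) \<le> t * card (W (Suc i))" by (simp add: algebra_simps)
    thus ?thesis using i by simp
  qed
  have W_ge: "i \<le> t \<Longrightarrow> b ^ i \<le> card (W i)" for i
  proof (induction i)
    case 0
    have "({}, r) \<in> W 0" using r by (auto simp: W_def)
    hence "card (W 0) \<noteq> 0" using finW by auto
    thus ?case by simp
  next
    case (Suc i)
    have "b ^ Suc i \<le> b * card (W i)" using Suc by simp
    also have "\<dots> \<le> card (W (Suc i))" using step Suc by simp
    finally show ?case .
  qed
  have "card V' < card (W t)"
    using card_mono[OF fin(1) V'] big W_ge[of t] by simp
  hence "\<not> inj_on snd (W t)"
    using card_inj_on_le[of snd "W t" V'] fin' W_sub[of t] by fastforce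
  then obtain w1 w2 where "w1 \<in> W t" "w2 \<in> W t" "snd w1 = snd w2" "w1 \<noteq> w2"
    unfolding inj_on_def by blast
  then obtain F1 F2 v where F12: "(F1, v) \<in> W t" "(F2, v) \<in> W t" "F1 \<noteq> F2"
    by (metis prod.collapse)
  define F where "F = (F1 - F2) \<union> (F2 - F1)"
  have sub: "F1 \<subseteq> E'" "F2 \<subseteq> E'" and inj: "inj_on \<chi> F1" "inj_on \<chi> F2"
    and card12: "card F1 = t" "card F2 = t"
    and par: "\<And>u. even (card {e\<in>F1. u \<in> ends e} + of_bool (u = r) + of_bool (u = v))"
      "\<And>u. even (card {e\<in>F2. u \<in> ends e} + of_bool (u = r) + of_bool (u = v))"
    using F12 by (auto simp: W_def)
  have fin12: "finite F1" "finite F2" using sub fin' finite_subset by auto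
  show ?thesis
  proof (rule that)
    show "F \<subseteq> E" using sub E' by (auto simp: F_def)
    show "F \<noteq> {}" using F12 by (auto simp: F_def)
    have "card F \<le> card (F1 \<union> F2)" using fin12 by (intro card_mono) (auto simp: F_def)
    thus "card F \<le> 2 * t" using card_Un_le[of F1 F2] card12 by simp
    \<comment> \<open>\<open>F1\<close> and \<open>F2\<close> have odd degree at the same vertices,
      so the parities cancel.\<close>
    show "even (card {e\<in>F. u \<in> ends e})" for u
    proof -
      have "{e\<in>F. u \<in> ends e} = ({e\<in>F1. u \<in> ends e} - {e\<in>F2. u \<in> ends e})
          \<union> ({e\<in>F2. u \<in> ends e} - {e\<in>F1. u \<in> ends e})" by (auto simp: F_def)
      hence "even (card {e\<in>F. u \<in> ends e})
          \<longleftrightarrow> even (card {e\<in>F1. u \<in> ends e} + card {e\<in>F2. u \<in> ends e})"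
        using even_card_symmetric_difference[of "{e\<in>F1. u \<in> ends e}" "{e\<in>F2. u \<in> ends e}"] fin12
        by simp
      thus ?thesis using par[of u] by auto
    qed
    \<comment> \<open>Each of \<open>F1\<close> and \<open>F2\<close> is rainbow and contributes at
      most one edge of color \<open>g\<close>.\<close>
    show "card {e\<in>F. \<chi> e = g} \<le> 2" for g
    proof -
      have le1: "card {e\<in>F'. \<chi> e = g} \<le> 1" if "inj_on \<chi> F'" "finite F'" for F'
        using that by (auto simp: card_le_Suc0_iff_eq inj_on_def)
      have "card {e\<in>F. \<chi> e = g} \<le> card ({e\<in>F1. \<chi> e = g} \<union> {e\<in>F2. \<chi> e = g})"
        using fin12 by (intro card_mono) (auto simp: F_def)
      also have "\<dots> \<le> card {e\<in>F1. \<chi> e = g} + card {e\<in>F2. \<chi> e = g}" by (rule card_Un_le)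
      finally show ?thesis using le1[OF inj(1) fin12(1)] le1[OF inj(2) fin12(2)] by simp
    qed
  qed
qed

section \<open>Repeated colors in complete bipartite pieces\<close>

text \<open>Here \<open>f x y\<close> is the color of the edge \<open>xy\<close>. The inequality
  says, without subtraction, that \<open>X\<close> and \<open>Y\<close> span fewer than
  \<open>p\<close> repeats. Sets smaller than \<open>p\<close> are allowed, since later
  constructions only bound the sizes from above.\<close>

definition few_repeats :: "nat \<Rightarrow> nat \<Rightarrow> (nat \<Rightarrow> nat \<Rightarrow> 'c) \<Rightarrow> bool" where
  "few_repeats p n f \<longleftrightarrow> (\<forall>X Y. X \<subseteq> {..<n} \<longrightarrow> Y \<subseteq> {..<n} \<longrightarrow> card X \<le> p \<longrightarrow> card Y \<le> p \<longrightarrow>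
     card X * card Y < card (case_prod f ` (X \<times> Y)) + p)"

lemma few_repeatsD:
  assumes "few_repeats p n f" "X \<subseteq> {..<n}" "Y \<subseteq> {..<n}" "card X \<le> p" "card Y \<le> p"
  shows "card X * card Y < card (case_prod f ` (X \<times> Y)) + p"
  using assms by (auto simp: few_repeats_def)

lemma card_image_superset_le:
  assumes "finite B" "A \<subseteq> B"
  shows "card (c ` B) + card A \<le> card (c ` A) + card B"
proof -
  have "c ` B = c ` A \<union> c ` (B - A)" using assms(2) by blast
  hence "card (c ` B) \<le> card (c ` A) + card (c ` (B - A))" by (simp add: card_Un_le)
  also have "card (c ` (B - A)) \<le> card (B - A)" using assms(1) by (intro card_image_le) auto
  also have "card (B - A) = card B - card A"
    using assms by (intro card_Diff_subset) (auto intro: finite_subset)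
  finally show ?thesis using card_mono[OF assms] by linarith
qed

text \<open>Smaller sets can be enlarged to size exactly \<open>p\<close> without losing repeats,
  and there \<open>p\<^sup>2 - p + 1\<close> colors leave at most \<open>p - 1\<close>
  repeats.\<close>

lemma few_repeatsI:
  assumes "p \<le> n"
    and ge: "\<And>X Y. X \<subseteq> {..<n} \<Longrightarrow> Y \<subseteq> {..<n} \<Longrightarrow> card X = p \<Longrightarrow> card Y = p \<Longrightarrow>
      p\<^sup>2 - p + 1 \<le> card (case_prod f ` (X \<times> Y))"
  shows "few_repeats p n f"
  unfolding few_repeats_def
proof (intro allI impI)
  fix X Y assume X: "X \<subseteq> {..<n}" "card X \<le> p" and Y: "Y \<subseteq> {..<n}" "card Y \<le> p"
  obtain X' where X': "X \<subseteq> X'" "X' \<subseteq> {..<n}" "card X' = p"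
    using exists_subset_between[of X p "{..<n}"] X assms(1) by auto
  obtain Y' where Y': "Y \<subseteq> Y'" "Y' \<subseteq> {..<n}" "card Y' = p"
    using exists_subset_between[of Y p "{..<n}"] Y assms(1) by auto
  have fin: "finite X'" "finite Y'" using X' Y' by (auto intro: finite_subset)
  have "card (case_prod f ` (X' \<times> Y')) + card (X \<times> Y)
      \<le> card (case_prod f ` (X \<times> Y)) + card (X' \<times> Y')"
    using X' Y' fin by (intro card_image_superset_le) auto
  moreover have "card (X' \<times> Y') = p\<^sup>2"
    using X' Y' by (simp add: card_cartesian_product power2_eq_square)
  moreover have "p \<le> p\<^sup>2" by (simp add: power2_eq_square)
  ultimately show "card X * card Y < card (case_prod f ` (X \<times> Y)) + p"
    using ge[OF X'(2) Y'(2) X'(3) Y'(3)] by (simp add: card_cartesian_product)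
qed

lemma few_repeats_swap:
  assumes "few_repeats p n f"
  shows "few_repeats p n (\<lambda>x y. f y x)"
  unfolding few_repeats_def
proof (intro allI impI)
  fix X Y assume "X \<subseteq> {..<n}" "Y \<subseteq> {..<n}" "card X \<le> p" "card Y \<le> p"
  hence "card Y * card X < card (case_prod f ` (Y \<times> X)) + p"
    by (intro few_repeatsD[OF assms])
  moreover have "case_prod f ` (Y \<times> X) = (\<lambda>(x, y). f y x) ` (X \<times> Y)" by force
  ultimately show "card X * card Y < card ((\<lambda>(x, y). f y x) ` (X \<times> Y)) + p"
    by (simp add: mult.commute)
qed

text \<open>Every edge outside \<open>X \<times> Y\<close> in a color already present costs at most one new vertex
  on each side and adds a repeat, so a large color class lets one pad the sets up to size \<open>p\<close>.\<close>

lemma few_repeats_large_class: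
  assumes few: "few_repeats p n f" and "m \<le> p"
    and XY: "X \<subseteq> {..<n}" "Y \<subseteq> {..<n}" "card X \<le> m" "card Y \<le> m"
    and g: "g \<in> case_prod f ` (X \<times> Y)"
    and large: "p\<^sup>2 < card {e \<in> {..<n} \<times> {..<n}. case_prod f e = g}"
  shows "card X * card Y < card (case_prod f ` (X \<times> Y)) + m"
  using \<open>m \<le> p\<close> XY g
\<comment> \<open>The induction runs downwards from \<open>m = p\<close>, where the claim is
  \<open>few_repeats\<close> itself.\<close>
proof (induction m arbitrary: X Y rule: inc_induct)
  case base
  thus ?case using few_repeatsD[OF few] by simp
next
  case (step m)
  have fin: "finite X" "finite Y" using step.prems by (auto intro: finite_subset)
  have "card (X \<times> Y) \<le> p * p"
    unfolding card_cartesian_product using step.prems(3,4) step.hyps by (intro mult_mono) auto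
  hence "card (X \<times> Y) < card {e \<in> {..<n} \<times> {..<n}. case_prod f e = g}"
    using large by (simp add: power2_eq_square)
  hence "\<not> {e \<in> {..<n} \<times> {..<n}. case_prod f e = g} \<subseteq> X \<times> Y"
    using card_mono[OF finite_cartesian_product[OF fin]] not_less by blast
  then obtain e where e: "e \<in> {..<n} \<times> {..<n}" "case_prod f e = g" "e \<notin> X \<times> Y" by blast
  obtain x y where "e = (x, y)" by (cases e)
  with e have xy: "x < n" "y < n" "f x y = g" "(x, y) \<notin> X \<times> Y" by simp_all
  \<comment> \<open>\<open>Z\<close> has one edge more than \<open>X \<times> Y\<close> and no new
    color, hence one more repeat, and \<open>?X \<times> ?Y\<close> has at least as many repeats as
    \<open>Z\<close>.\<close>
  define Z where "Z = insert (x, y) (X \<times> Y)"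
  let ?X = "insert x X" and ?Y = "insert y Y"
  have "card ?X * card ?Y < card (case_prod f ` (?X \<times> ?Y)) + Suc m"
  proof (rule step.IH)
    show "card ?X \<le> Suc m" "card ?Y \<le> Suc m"
      using step.prems fin by (auto simp: card_insert_if)
    have "X \<times> Y \<subseteq> ?X \<times> ?Y" by auto
    thus "g \<in> case_prod f ` (?X \<times> ?Y)" using step.prems(5) by blast
  qed (use xy step.prems in auto)
  moreover have "card (case_prod f ` (?X \<times> ?Y)) + card Z
      \<le> card (case_prod f ` Z) + card (?X \<times> ?Y)"
    using fin by (intro card_image_superset_le) (auto simp: Z_def)
  moreover have "card (case_prod f ` Z) = card (case_prod f ` (X \<times> Y))"
    using step.prems(5) xy(3) by (simp add: Z_def insert_absorb)
  moreover have "card Z = Suc (card X * card Y)"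
    using fin xy(4) by (simp add: Z_def card_cartesian_product)
  moreover have "card (?X \<times> ?Y) = card ?X * card ?Y" by (rule card_cartesian_product)
  ultimately show "card X * card Y < card (case_prod f ` (X \<times> Y)) + m" by linarith
qed

text \<open>If \<open>v'\<close> repeated a color on two leaves of the star, then \<open>v\<close>,
  \<open>v'\<close> and \<open>p\<close> leaves would span \<open>2 * p\<close> edges with at most
  \<open>1 + (p - 1)\<close> colors, which is \<open>p\<close> repeats.\<close>

lemma few_repeats_star:
  assumes few: "few_repeats p n f" and "2 \<le> p"
    and v: "v < n" "v' < n" "v \<noteq> v'"
    and Y: "Y \<subseteq> {..<n}" "p \<le> card Y" "\<And>z. z \<in> Y \<Longrightarrow> f v z = g"
    and y: "y \<in> Y" "y' \<in> Y" "y \<noteq> y'"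
  shows "f v' y \<noteq> f v' y'"
proof
  assume eq: "f v' y = f v' y'"
  have "finite Y" using Y(1) by (rule finite_subset) auto
  then obtain Y0 where Y0: "{y, y'} \<subseteq> Y0" "Y0 \<subseteq> Y" "card Y0 = p"
    using exists_subset_between[of "{y, y'}" p Y] Y y \<open>2 \<le> p\<close> by auto
  have fin: "finite Y0" using Y0 \<open>finite Y\<close> finite_subset by auto
  have "card {v, v'} * card Y0 < card (case_prod f ` ({v, v'} \<times> Y0)) + p"
    using Y0 Y v \<open>2 \<le> p\<close> by (intro few_repeatsD[OF few]) auto
  moreover have "case_prod f ` ({v, v'} \<times> Y0) \<subseteq> insert g (f v' ` (Y0 - {y}))"
  proof
    fix a assume "a \<in> case_prod f ` ({v, v'} \<times> Y0)"
    then obtain z where z: "z \<in> Y0" "a = f v z \<or> a = f v' z" by auto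
    have "f v z = g" using z Y0 Y by auto
    moreover have "f v' z \<in> f v' ` (Y0 - {y})"
    proof (cases "z = y")
      case True
      thus ?thesis using eq y Y0 by (auto intro!: image_eqI[of _ _ y'])
    qed (use z in auto)
    ultimately show "a \<in> insert g (f v' ` (Y0 - {y}))" using z by auto
  qed
  hence "card (case_prod f ` ({v, v'} \<times> Y0)) \<le> card (insert g (f v' ` (Y0 - {y})))"
    using fin by (intro card_mono) auto
  moreover have "card (insert g (f v' ` (Y0 - {y}))) \<le> Suc (card (f v' ` (Y0 - {y})))"
    using fin by (simp add: card_insert_if)
  moreover have "card (f v' ` (Y0 - {y})) \<le> card (Y0 - {y})"
    using fin by (intro card_image_le) auto
  moreover have "card (Y0 - {y}) = p - 1" using Y0 fin by simp
  ultimately show False using Y0(3) v(3) \<open>2 \<le> p\<close> by simp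
qed

text \<open>Each edge \<open>vy\<close> counted here has at least \<open>p - 1\<close>, hence three,
  further leaves \<open>z\<close> in its star. By \<open>few_repeats_star\<close> the pair
  \<open>(y, z)\<close> determines the center \<open>v\<close>, so there are at most
  \<open>n\<^sup>2\<close> such triples.\<close>

lemma few_repeats_star_edges:
  assumes few: "few_repeats p n f" and p: "4 \<le> p"
  shows "3 * card {(v, y) \<in> {..<n} \<times> {..<n}. p \<le> card {z \<in> {..<n}. f v z = f v y}} \<le> n\<^sup>2"
proof -
  define S where "S = (\<lambda>(v, y). {z \<in> {..<n}. f v z = f v y} - {y})"
  define B where "B = {(v, y) \<in> {..<n} \<times> {..<n}. p \<le> card {z \<in> {..<n}. f v z = f v y}}"
  have finB: "finite B" by (rule finite_subset[of _ "{..<n} \<times> {..<n}"]) (auto simp: B_def)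
  have finS: "finite (S e)" for e by (auto simp: S_def split: prod.splits)
  have "3 \<le> card (S e)" if "e \<in> B" for e
    using that p by (auto simp: B_def S_def card_Diff_singleton)
  hence "(\<Sum>e\<in>B. 3) \<le> (\<Sum>e\<in>B. card (S e))" by (intro sum_mono) auto
  also have "\<dots> = card (Sigma B S)" using finB finS by (simp add: card_SigmaI)
  also have "\<dots> \<le> card ({..<n} \<times> {..<n})"
  proof (rule card_inj_on_le[where f = "\<lambda>((v, y), z). (y, z)"])
    show "inj_on (\<lambda>((v, y), z). (y, z)) (Sigma B S)"
    proof (rule inj_onI, clarsimp)
      fix v v' y z assume *: "(v, y) \<in> B" "(v', y) \<in> B" "z \<in> S (v, y)" "z \<in> S (v', y)"
      show "v = v'"
      proof (rule ccontr)
        assume "v \<noteq> v'"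
        hence "f v' y \<noteq> f v' z"
          using * p by (intro few_repeats_star[OF few, of v v' "{z \<in> {..<n}. f v z = f v y}" "f v y"])
            (auto simp: B_def S_def)
        thus False using * by (auto simp: S_def)
      qed
    qed
  qed (auto simp: B_def S_def)
  finally show ?thesis by (simp add: B_def card_cartesian_product power2_eq_square)
qed

section \<open>The color energy graph\<close>

lemma card_even_fibres:
  assumes "finite F" "\<And>l. even (card {e\<in>F. h e = l})"
  shows "2 * card (h ` F) \<le> card F"
proof -
  have "2 \<le> card {e\<in>F. h e = l}" if "l \<in> h ` F" for l
  proof -
    have "{e\<in>F. h e = l} \<noteq> {}" using that by auto
    hence "card {e\<in>F. h e = l} \<noteq> 0" using assms(1) by simp
    thus ?thesis using assms(2)[of l] by (cases "card {e\<in>F. h e = l} = 1") auto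
  qed
  hence "(\<Sum>l\<in>h ` F. 2) \<le> (\<Sum>l\<in>h ` F. card {e\<in>F. h e = l})" by (intro sum_mono) auto
  also have "\<dots> = card F"
    using sum.image_gen[OF assms(1), of "\<lambda>_. 1::nat" h] by simp
  finally show ?thesis by simp
qed

text \<open>There are at most half as many labels as elements of \<open>F\<close>, and each label is
  a pair. Applied to energy graph edges, this bounds the vertices of the original graph on one
  side.\<close>

lemma card_even_fibres_UN:
  fixes h :: "'a \<Rightarrow> 'b \<times> 'b"
  assumes "finite F" "\<And>l. even (card {e\<in>F. h e = l})"
  shows "card (\<Union>e\<in>F. {fst (h e), snd (h e)}) \<le> card F"
proof -
  have "(\<Union>e\<in>F. {fst (h e), snd (h e)}) = (\<Union>l\<in>h ` F. {fst l, snd l})" by auto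
  also have "card \<dots> \<le> (\<Sum>l\<in>h ` F. card {fst l, snd l})"
    using assms(1) by (intro card_UN_le) auto
  also have "\<dots> \<le> (\<Sum>l\<in>h ` F. 2)" by (intro sum_mono) (auto simp: card_insert_if)
  also have "\<dots> \<le> card F" using card_even_fibres[OF assms] by simp
  finally show ?thesis .
qed

text \<open>One pair needs two elements, and two pairs need three because each pair occurs in only
  one orientation. The bound 2 rules out triangles, with three pairs on three elements. So
  \<open>r\<close> pairs in one color give at least \<open>r\<close> repeats.\<close>

lemma card_pairs_less:
  fixes S :: "('a::linorder \<times> 'b) set"
  assumes "finite S" "S \<noteq> {}" "card R \<le> 2"
    and R: "\<And>e e'. (e, e') \<in> R \<Longrightarrow> e \<in> S \<and> e' \<in> S \<and> fst e < fst e'"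
  shows "card R < card S"
proof (rule ccontr)
  assume "\<not> card R < card S"
  moreover have "card S \<noteq> 0" using assms by simp
  ultimately consider "card S = 1" "card R \<noteq> 0" | "card S = 2" "card R = 2"
    using assms(3) by linarith
  thus False
  proof cases
    case 1
    then obtain s where "S = {s}" by (auto simp: card_1_singleton_iff)
    moreover have "R \<noteq> {}" using 1 by auto
    ultimately show False using R by fastforce
  next
    case 2
    then obtain s s' where S: "S = {s, s'}" by (auto simp: card_2_iff)
    have "R \<subseteq> {if fst s < fst s' then (s, s') else (s', s)}"
      using R S by fastforce
    from card_mono[OF _ this] have "card R \<le> 1" by simp
    thus False using 2 by simp
  qed
qed

lemma card_Sigma_le:
  assumes "finite A" "\<And>x. x \<in> A \<Longrightarrow> finite (R x)" "\<And>x. x \<in> A \<Longrightarrow> card (R x) \<le> p"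
  shows "card (Sigma A R) \<le> card A * p"
  using sum_bounded_above[of A "\<lambda>x. card (R x)" p] assms by (simp add: card_SigmaI)

text \<open>By Cauchy-Schwarz there are at least \<open>(card G)\<^sup>2 / k\<close> ordered pairs
  of edges of equal color. Pairs sharing an endpoint (\<open>Q1\<close> and \<open>Q2\<close>) make
  up at most half of this bound, and the rest is \<open>P\<close> together with its
  reversal.\<close>

lemma energy_lower_bound:
  fixes f :: "nat \<Rightarrow> nat \<Rightarrow> 'c"
  defines "c \<equiv> case_prod f"
  assumes finG: "finite G" and k: "card (c ` G) \<le> k"
    and row: "\<And>a g. card {x. (a, x) \<in> G \<and> f a x = g} \<le> p"
    and col: "\<And>x g. card {a. (a, x) \<in> G \<and> f a x = g} \<le> p"
    and G: "n\<^sup>2 \<le> 4 * card G" "16 * p * k \<le> n\<^sup>2"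
  shows "n ^ 4 \<le> 64 * k * card {(e, e') \<in> G \<times> G. c e = c e' \<and> fst e < fst e' \<and> snd e \<noteq> snd e'}"
proof -
  define P where "P = {(e, e') \<in> G \<times> G. c e = c e' \<and> fst e < fst e' \<and> snd e \<noteq> snd e'}"
  define Q where "Q = Sigma G (\<lambda>e. {e' \<in> G. c e = c e'})"
  define Q1 where "Q1 = Sigma G (\<lambda>e. {e' \<in> G. c e = c e' \<and> fst e = fst e'})"
  define Q2 where "Q2 = Sigma G (\<lambda>e. {e' \<in> G. c e = c e' \<and> snd e = snd e'})"
  define m where "m g = card {e \<in> G. c e = g}" for g
  have fin: "finite P" "finite Q" "finite Q1" "finite Q2"
    using finG by (auto simp: P_def Q_def Q1_def Q2_def intro: finite_subset[of _ "G \<times> G"])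
  have "card Q = (\<Sum>e\<in>G. card {e' \<in> G. c e = c e'})"
    unfolding Q_def using finG by (intro card_SigmaI) auto
  also have "\<dots> = (\<Sum>g\<in>c ` G. \<Sum>e | e \<in> G \<and> c e = g. card {e' \<in> G. c e = c e'})"
    by (rule sum.image_gen[OF finG])
  also have "\<dots> = (\<Sum>g\<in>c ` G. \<Sum>e | e \<in> G \<and> c e = g. m g)"
    by (intro sum.cong refl) (auto simp: m_def intro!: arg_cong[of _ _ card])
  also have "\<dots> = (\<Sum>g\<in>c ` G. (m g)\<^sup>2)"
    by (simp add: m_def power2_eq_square)
  finally have cardQ: "card Q = (\<Sum>g\<in>c ` G. (m g)\<^sup>2)" .
  have "card G = (\<Sum>g\<in>c ` G. m g)"
    using sum.image_gen[OF finG, of "\<lambda>_. 1::nat" c] by (simp add: m_def)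
  hence "real ((card G)\<^sup>2) = (\<Sum>g\<in>c ` G. real (m g))\<^sup>2" by simp
  also have "\<dots> \<le> (\<Sum>g\<in>c ` G. (real (m g))\<^sup>2) * real (card (c ` G))"
    by (rule sum_squared_le_sum_of_squares)
  also have "\<dots> = real (card Q * card (c ` G))" by (simp add: cardQ)
  also have "\<dots> \<le> real (card Q * k)"
    using k by (intro of_nat_mono mult_le_mono) auto
  finally have GQ: "(card G)\<^sup>2 \<le> card Q * k" by (simp only: of_nat_le_iff)
  have "card {e' \<in> G. c e = c e' \<and> fst e = fst e'} \<le> p" for e
  proof -
    obtain a x where e: "e = (a, x)" by (cases e)
    have "{e' \<in> G. c e = c e' \<and> fst e = fst e'} = Pair a ` {y. (a, y) \<in> G \<and> f a y = f a x}"
      by (auto simp: e c_def)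
    thus ?thesis using row[of a "f a x"] by (simp add: card_image inj_on_def)
  qed
  hence "card Q1 \<le> card G * p"
    unfolding Q1_def using finG by (intro card_Sigma_le) simp_all
  moreover have "card {e' \<in> G. c e = c e' \<and> snd e = snd e'} \<le> p" for e
  proof -
    obtain a x where e: "e = (a, x)" by (cases e)
    have "{e' \<in> G. c e = c e' \<and> snd e = snd e'} = (\<lambda>b. (b, x)) ` {b. (b, x) \<in> G \<and> f b x = f a x}"
      by (auto simp: e c_def)
    thus ?thesis using col[of x "f a x"] by (simp add: card_image inj_on_def)
  qed
  hence "card Q2 \<le> card G * p"
    unfolding Q2_def using finG by (intro card_Sigma_le) simp_all
  moreover have "Q \<subseteq> (Q1 \<union> Q2) \<union> (P \<union> prod.swap ` P)"
  proof
    fix q assume "q \<in> Q"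
    moreover obtain e e' where q: "q = (e, e')" by (cases q)
    ultimately have *: "e \<in> G" "e' \<in> G" "c e = c e'" by (auto simp: Q_def)
    consider "fst e = fst e'" | "snd e = snd e'" | "fst e < fst e'" "snd e \<noteq> snd e'"
      | "fst e' < fst e" "snd e \<noteq> snd e'" by linarith
    thus "q \<in> (Q1 \<union> Q2) \<union> (P \<union> prod.swap ` P)"
    proof cases
      case 4
      hence "(e', e) \<in> P" using * by (simp add: P_def)
      thus ?thesis using q by (force intro: image_eqI[of _ _ "(e', e)"])
    qed (use * in \<open>simp_all add: q P_def Q1_def Q2_def\<close>)
  qed
  hence "card Q \<le> card ((Q1 \<union> Q2) \<union> (P \<union> prod.swap ` P))"
    using fin by (intro card_mono) auto
  moreover have "card ((Q1 \<union> Q2) \<union> (P \<union> prod.swap ` P)) \<le> card Q1 + card Q2 + (card P + card P)"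
    by (intro order.trans[OF card_Un_le] add_mono order.trans[OF card_Un_le] order.refl
        card_image_le fin)
  ultimately have "card Q \<le> 2 * (card G * p) + 2 * card P" by linarith
  hence "card Q * k \<le> (2 * (card G * p) + 2 * card P) * k" by (rule mult_le_mono1)
  with GQ have "(card G)\<^sup>2 \<le> 2 * (p * k * card G) + 2 * (k * card P)"
    by (simp add: algebra_simps)
  \<comment> \<open>From \<open>16 * p * k \<le> n\<^sup>2 \<le> 4 * card G\<close>.\<close>
  moreover have "4 * (p * k) * card G \<le> card G * card G"
    using G by (intro mult_le_mono1) linarith
  hence "4 * (p * k * card G) \<le> (card G)\<^sup>2" by (simp add: power2_eq_square)
  ultimately have "(card G)\<^sup>2 \<le> 4 * (k * card P)" by linarith
  moreover have "(n\<^sup>2)\<^sup>2 \<le> (4 * card G)\<^sup>2" using G(1) by (intro power_mono) auto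
  hence "n ^ 4 \<le> 16 * (card G)\<^sup>2" by (simp add: power_mult_distrib)
  ultimately show ?thesis unfolding P_def[symmetric] by simp
qed

text \<open>The even-degree condition makes the pairs of \<open>F\<close> span at most \<open>card F\<close> vertices on each
  side, while no color accounts for more than two of them, so that they are
  \<open>card F\<close> independent repeats.\<close>

lemma few_repeats_no_even_energy_graph:
  fixes f :: "nat \<Rightarrow> nat \<Rightarrow> 'c"
  defines "c \<equiv> case_prod f"
  assumes few: "few_repeats p n f"
    and F: "finite F" "F \<noteq> {}" "card F \<le> p"
    and pairs: "\<And>e e'. (e, e') \<in> F \<Longrightarrow> e \<in> {..<n} \<times> {..<n} \<and> e' \<in> {..<n} \<times> {..<n} \<and>
      c e = c e' \<and> fst e < fst e' \<and> p\<^sup>2 < card {e'' \<in> {..<n} \<times> {..<n}. c e'' = c e}"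
    and even1: "\<And>l. even (card {q\<in>F. (fst (fst q), fst (snd q)) = l})"
    and even2: "\<And>l. even (card {q\<in>F. (snd (fst q), snd (snd q)) = l})"
    and two: "\<And>g. card {q\<in>F. c (fst q) = g} \<le> 2"
  shows False
proof -
  define X where "X = (\<Union>q\<in>F. {fst (fst q), fst (snd q)})"
  define Y where "Y = (\<Union>q\<in>F. {snd (fst q), snd (snd q)})"
  have X: "card X \<le> card F" and Y: "card Y \<le> card F"
    using card_even_fibres_UN[OF F(1) even1] card_even_fibres_UN[OF F(1) even2]
    by (simp_all add: X_def Y_def)
  have fin: "finite X" "finite Y" using F by (auto simp: X_def Y_def)
  have sub: "X \<subseteq> {..<n}" "Y \<subseteq> {..<n}"
    using pairs by (fastforce simp: X_def Y_def)+
  have inXY: "e \<in> X \<times> Y" "e' \<in> X \<times> Y" if "(e, e') \<in> F" for e e'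
    using that by (force simp: X_def Y_def mem_Times_iff)+
  obtain e e' where q: "(e, e') \<in> F" using F(2) by auto
  \<comment> \<open>Fewer than \<open>card F\<close> repeats are possible, by padding with the large
    color class of \<open>e\<close>; the count below finds \<open>card F\<close> of them.\<close>
  have "card X * card Y < card (c ` (X \<times> Y)) + card F"
    unfolding c_def
  proof (rule few_repeats_large_class[OF few F(3) sub X Y])
    show "case_prod f e \<in> case_prod f ` (X \<times> Y)" using inXY[OF q] by blast
    show "p\<^sup>2 < card {e'' \<in> {..<n} \<times> {..<n}. case_prod f e'' = case_prod f e}"
      using pairs[OF q] unfolding c_def by blast
  qed
  moreover have "card F + card (c ` (X \<times> Y)) \<le> card X * card Y"
  proof -
    have finZ: "finite (X \<times> Y)" using fin by simp
    have "card F = (\<Sum>g\<in>(\<lambda>q. c (fst q)) ` F. card {q\<in>F. c (fst q) = g})"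
      using sum.image_gen[OF F(1), of "\<lambda>_. 1::nat" "\<lambda>q. c (fst q)"] by simp
    also have "\<dots> \<le> (\<Sum>g\<in>c ` (X \<times> Y). card {q\<in>F. c (fst q) = g})"
      using finZ inXY by (intro sum_mono2) force+
    \<comment> \<open>It remains to compare color by color: a color with \<open>r\<close> pairs in
      \<open>F\<close> must occur on at least \<open>r + 1\<close> edges, also when
      \<open>r = 0\<close>.\<close>
    finally have "card F + card (c ` (X \<times> Y)) \<le> (\<Sum>g\<in>c ` (X \<times> Y). card {q\<in>F. c (fst q) = g} + 1)"
      by (simp add: sum.distrib del: One_nat_def)
    also have "\<dots> \<le> (\<Sum>g\<in>c ` (X \<times> Y). card {z \<in> X \<times> Y. c z = g})"
    proof (rule sum_mono)
      fix g assume g: "g \<in> c ` (X \<times> Y)"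
      have "card {q\<in>F. c (fst q) = g} < card {z \<in> X \<times> Y. c z = g}"
      proof (rule card_pairs_less)
        show "{z \<in> X \<times> Y. c z = g} \<noteq> {}" using g by blast
        show "e \<in> {z \<in> X \<times> Y. c z = g} \<and> e' \<in> {z \<in> X \<times> Y. c z = g} \<and> fst e < fst e'"
          if "(e, e') \<in> {q\<in>F. c (fst q) = g}" for e e'
          using that inXY[of e e'] pairs[of e e'] by simp
      qed (use finZ two in auto)
      thus "card {q\<in>F. c (fst q) = g} + 1 \<le> card {z \<in> X \<times> Y. c z = g}" by simp
    qed
    also have "\<dots> = card (X \<times> Y)"
      using sum.image_gen[OF finZ, of "\<lambda>_. 1::nat" c] by simp
    finally show ?thesis by (simp add: card_cartesian_product)
  qed
  ultimately show False by simp
qed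

section \<open>The bound on the number of colors\<close>

text \<open>If \<open>k\<close> were smaller, the energy graph would be dense enough for
  \<open>even_subgraph_few_colors\<close> with \<open>K = p\<^sup>2\<close>, and the resulting even
  subgraph contradicts \<open>few_repeats\<close>. The parameter \<open>b\<close> is the branching
  factor of the trails, and \<open>2 * n\<^sup>2\<close> is the number of vertices of the energy
  graph.\<close>

lemma colors_lower_bound:
  fixes f :: "nat \<Rightarrow> nat \<Rightarrow> 'c" and n p b :: nat
  defines "t \<equiv> p div 2" and "k \<equiv> card (case_prod f ` ({..<n} \<times> {..<n}))"
  assumes few: "few_repeats p n f" and p: "4 \<le> p" and n: "1 \<le> n" and b: "2 * n\<^sup>2 < b ^ t"
  shows "n\<^sup>2 \<le> 128 * k * (t * p\<^sup>2 + t * b)"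
proof (rule ccontr)
  define c where "c = case_prod f"
  define A where "A = {..<n} \<times> {..<n}"
  \<comment> \<open>\<open>B1\<close> and \<open>B2\<close> are the edges in large monochromatic
    stars centered on the left and on the right; \<open>S\<close> consists of the edges in small
    color classes.\<close>
  define B1 where "B1 = {(v, y) \<in> {..<n} \<times> {..<n}. p \<le> card {z \<in> {..<n}. f v z = f v y}}"
  define B2 where "B2 = {(y, v) \<in> {..<n} \<times> {..<n}. p \<le> card {z \<in> {..<n}. f z v = f y v}}"
  define S where "S = {e \<in> A. card {e' \<in> A. c e' = c e} \<le> p\<^sup>2}"
  define G where "G = A - (B1 \<union> B2 \<union> S)"
  assume "\<not> n\<^sup>2 \<le> 128 * k * (t * p\<^sup>2 + t * b)"
  hence k: "128 * k * (t * p\<^sup>2 + t * b) < n\<^sup>2" by simp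
  have finA: "finite A" and cardA: "card A = n\<^sup>2"
    by (simp_all add: A_def card_cartesian_product power2_eq_square)
  have sub: "B1 \<subseteq> A" "B2 \<subseteq> A" "S \<subseteq> A" by (auto simp: A_def B1_def B2_def S_def)
  have fin: "finite B1" "finite B2" "finite S" "finite G"
    using sub finA by (auto simp: G_def intro: finite_subset)
  have B1: "3 * card B1 \<le> n\<^sup>2"
    unfolding B1_def by (rule few_repeats_star_edges[OF few p])
  have "B2 = prod.swap ` {(v, y) \<in> {..<n} \<times> {..<n}. p \<le> card {z \<in> {..<n}. f z v = f y v}}"
    by (force simp: B2_def)
  hence B2: "3 * card B2 \<le> n\<^sup>2"
    using few_repeats_star_edges[OF few_repeats_swap[OF few] p] by (simp add: card_image)
  have S: "card S \<le> k * p\<^sup>2"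
  proof -
    have "S = (\<Union>g\<in>c ` S. {e \<in> S. c e = g})" by auto
    also have "card \<dots> \<le> (\<Sum>g\<in>c ` S. card {e \<in> S. c e = g})"
      using fin by (intro card_UN_le) auto
    also have "\<dots> \<le> (\<Sum>g\<in>c ` S. p\<^sup>2)"
    proof (rule sum_mono, clarify)
      fix e assume e: "e \<in> S"
      have "card {e' \<in> S. c e' = c e} \<le> card {e' \<in> A. c e' = c e}"
        using finA sub by (intro card_mono) auto
      thus "card {e' \<in> S. c e' = c e} \<le> p\<^sup>2" using e by (simp add: S_def)
    qed
    also have "\<dots> = card (c ` S) * p\<^sup>2" by simp
    also have "card (c ` S) \<le> k"
      unfolding k_def c_def using sub by (intro card_mono) (auto simp: A_def)
    finally show ?thesis by simp
  qed
  have t: "1 \<le> t" "2 * t \<le> p" using p by (auto simp: t_def)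
  have "1 * p\<^sup>2 \<le> t * p\<^sup>2 + t * b" using t by (intro trans_le_add1 mult_le_mono1)
  hence "128 * k * (1 * p\<^sup>2) \<le> 128 * k * (t * p\<^sup>2 + t * b)" by (rule mult_le_mono2)
  from le_less_trans[OF this k] have kp: "128 * (k * p\<^sup>2) < n\<^sup>2" by simp
  \<comment> \<open>At least \<open>n\<^sup>2 * (1 - 1/3 - 1/3 - 1/128)\<close> edges
    remain.\<close>
  have cardG: "n\<^sup>2 \<le> 4 * card G"
  proof -
    have "A \<subseteq> G \<union> (B1 \<union> (B2 \<union> S))" by (auto simp: G_def)
    hence "card A \<le> card (G \<union> (B1 \<union> (B2 \<union> S)))" using fin by (intro card_mono) auto
    also have "\<dots> \<le> card G + (card B1 + (card B2 + card S))"
      by (intro order.trans[OF card_Un_le] add_mono order.refl)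
    finally show ?thesis using B1 B2 S kp cardA by linarith
  qed
  have "p * k \<le> k * p\<^sup>2" by (simp add: power2_eq_square)
  hence pk: "16 * p * k \<le> n\<^sup>2" using kp by linarith
  \<comment> \<open>An edge outside \<open>B1\<close> lies in fewer than \<open>p\<close> edges of
    its color at its left end; \<open>col\<close> is the same at the right end.\<close>
  have row: "card {x. (a, x) \<in> G \<and> f a x = g} \<le> p" for a g
  proof (cases "\<exists>x. (a, x) \<in> G \<and> f a x = g")
    case True
    then obtain x where x: "(a, x) \<in> G" "f a x = g" by blast
    have "card {x. (a, x) \<in> G \<and> f a x = g} \<le> card {z \<in> {..<n}. f a z = f a x}"
      using x by (intro card_mono) (auto simp: G_def A_def)
    also have "\<dots> < p" using x by (auto simp: G_def A_def B1_def)
    finally show ?thesis by simp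
  next
    case False
    hence "{x. (a, x) \<in> G \<and> f a x = g} = {}" by blast
    thus ?thesis by (metis card.empty le0)
  qed
  have col: "card {a. (a, x) \<in> G \<and> f a x = g} \<le> p" for x g
  proof (cases "\<exists>a. (a, x) \<in> G \<and> f a x = g")
    case True
    then obtain a where a: "(a, x) \<in> G" "f a x = g" by blast
    have "card {a. (a, x) \<in> G \<and> f a x = g} \<le> card {z \<in> {..<n}. f z x = f a x}"
      using a by (intro card_mono) (auto simp: G_def A_def)
    also have "\<dots> < p" using a by (auto simp: G_def A_def B2_def)
    finally show ?thesis by simp
  next
    case False
    hence "{a. (a, x) \<in> G \<and> f a x = g} = {}" by blast
    thus ?thesis by (metis card.empty le0)
  qed
  define E where "E = {(e, e') \<in> G \<times> G. c e = c e' \<and> fst e < fst e' \<and> snd e \<noteq> snd e'}"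
  have "card (c ` G) \<le> k"
    unfolding k_def c_def by (intro card_mono) (auto simp: G_def A_def)
  hence energy: "n ^ 4 \<le> 64 * k * card E"
    unfolding E_def c_def using fin row col cardG pk by (intro energy_lower_bound) auto
  \<comment> \<open>The pair of edges \<open>ax\<close>, \<open>by\<close> joins the vertex pair
    \<open>(a, b)\<close> on the left to \<open>(x, y)\<close> on the right.\<close>
  define ends :: "(nat \<times> nat) \<times> (nat \<times> nat) \<Rightarrow> ((nat \<times> nat) + (nat \<times> nat)) set" where
    "ends q = {Inl (fst (fst q), fst (snd q)), Inr (snd (fst q), snd (snd q))}" for q
  define V where "V = A <+> A"
  have cardV: "card V = 2 * n\<^sup>2" using finA cardA by (simp add: V_def card_Plus)
  have finE: "finite E" using fin by (auto simp: E_def intro: finite_subset[of _ "G \<times> G"])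
  obtain F where F: "F \<subseteq> E" "F \<noteq> {}" "card F \<le> 2 * t"
    and even: "\<And>v. even (card {q\<in>F. v \<in> ends q})"
    and two: "\<And>g. card {q\<in>F. c (fst q) = g} \<le> 2"
  proof (rule even_subgraph_few_colors[of V E ends "\<lambda>q. c (fst q)" "p\<^sup>2" t b])
    show "finite V" "finite E" using finA finE by (auto simp: V_def)
    show "E \<noteq> {}" using energy n by auto
    show "ends q \<subseteq> V" if "q \<in> E" for q
      using that by (auto simp: E_def G_def A_def V_def ends_def)
    show "card (ends q) = 2" for q by (simp add: ends_def)
    show "card V < b ^ t" using b cardV by simp
    \<comment> \<open>Otherwise the energy is too small: \<open>128\<close> is \<open>64\<close>
      from the energy bound times \<open>2\<close> from \<open>card V\<close>.\<close>
    show "(t * p\<^sup>2 + t * b) * card V \<le> card E"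
    proof (rule ccontr)
      assume "\<not> ?thesis"
      hence "64 * k * card E \<le> 64 * k * ((t * p\<^sup>2 + t * b) * card V)" by simp
      also have "\<dots> = 128 * k * (t * p\<^sup>2 + t * b) * n\<^sup>2" by (simp add: cardV)
      also have "\<dots> < n\<^sup>2 * n\<^sup>2" using k n by (intro mult_strict_right_mono) auto
      also have "\<dots> = n ^ 4" by (simp add: power2_eq_square power4_eq_xxxx)
      finally show False using energy by simp
    qed
    \<comment> \<open>At the vertex \<open>(a, b)\<close> an edge of color \<open>g\<close> is given
      by \<open>x\<close> and \<open>y\<close> such that \<open>ax\<close> and \<open>by\<close>
      have color \<open>g\<close>, with at most \<open>p\<close> choices for each.\<close>
    show "card {q\<in>E. v \<in> ends q \<and> c (fst q) = g} \<le> p\<^sup>2" for v g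
    proof (cases v)
      case (Inl ab)
      obtain a b where ab: "ab = (a, b)" by (cases ab)
      let ?R = "\<lambda>a. {x. (a, x) \<in> G \<and> f a x = g}"
      have fR: "finite (?R a)" for a
        by (rule finite_subset[of _ "{..<n}"]) (auto simp: G_def A_def)
      have "{q\<in>E. v \<in> ends q \<and> c (fst q) = g} \<subseteq> (\<lambda>(x, y). ((a, x), (b, y))) ` (?R a \<times> ?R b)"
        by (auto simp: E_def c_def ends_def Inl ab)
      hence "card {q\<in>E. v \<in> ends q \<and> c (fst q) = g} \<le> card (?R a \<times> ?R b)"
        using fR by (intro surj_card_le) auto
      also have "\<dots> \<le> p * p"
        unfolding card_cartesian_product by (intro mult_le_mono row)
      finally show ?thesis by (simp add: power2_eq_square)
    next
      case (Inr ab)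
      obtain x y where xy: "ab = (x, y)" by (cases ab)
      let ?R = "\<lambda>x. {a. (a, x) \<in> G \<and> f a x = g}"
      have fR: "finite (?R a)" for a
        by (rule finite_subset[of _ "{..<n}"]) (auto simp: G_def A_def)
      have "{q\<in>E. v \<in> ends q \<and> c (fst q) = g} \<subseteq> (\<lambda>(a, b). ((a, x), (b, y))) ` (?R x \<times> ?R y)"
        by (auto simp: E_def c_def ends_def Inr xy)
      hence "card {q\<in>E. v \<in> ends q \<and> c (fst q) = g} \<le> card (?R x \<times> ?R y)"
        using fR by (intro surj_card_le) auto
      also have "\<dots> \<le> p * p"
        unfolding card_cartesian_product by (intro mult_le_mono col)
      finally show ?thesis by (simp add: power2_eq_square)
    qed
  qed (rule that; assumption)
  show False
  proof (rule few_repeats_no_even_energy_graph[OF few _ F(2)])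
    show "finite F" using F(1) finE by (rule finite_subset)
    show "card F \<le> p" using F(3) t by simp
    show "card {q\<in>F. case_prod f (fst q) = g} \<le> 2" for g using two[of g] by (simp add: c_def)
    \<comment> \<open>A left vertex is an end of \<open>q\<close> only through the first
      coordinates, so its degree is the size of a fibre.\<close>
    show "even (card {q\<in>F. (fst (fst q), fst (snd q)) = l})" for l
      using even[of "Inl l"] by (simp add: ends_def eq_commute)
    show "even (card {q\<in>F. (snd (fst q), snd (snd q)) = l})" for l
      using even[of "Inr l"] by (simp add: ends_def eq_commute)
    show "e \<in> {..<n} \<times> {..<n} \<and> e' \<in> {..<n} \<times> {..<n} \<and> case_prod f e = case_prod f e' \<and>
      fst e < fst e' \<and> p\<^sup>2 < card {e'' \<in> {..<n} \<times> {..<n}. case_prod f e'' = case_prod f e}"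
      if "(e, e') \<in> F" for e e'
    proof -
      have e: "e \<in> G" "e' \<in> G" "c e = c e'" "fst e < fst e'"
        using that F(1) by (auto simp: E_def)
      have "e \<in> A" "e' \<in> A" "\<not> card {e' \<in> A. c e' = c e} \<le> p\<^sup>2"
        using e(1,2) by (auto simp: G_def S_def)
      thus ?thesis using e unfolding A_def c_def not_le by blast
    qed
  qed
qed

section \<open>From graph colorings to the asymptotic bound\<close>

lemma edges_complete_bipartite:
  "edges (complete_bipartite m n) = (\<lambda>(i, j). {Inl i, Inr j}) ` ({..<m} \<times> {..<n})"
  by (simp add: complete_bipartite_def image_def) blast

lemma inj_on_map_sum_Plus:
  assumes "inj_on g X" "inj_on h Y"
  shows "inj_on (map_sum g h) (X <+> Y)"
proof (rule inj_onI)
  fix u v assume "u \<in> X <+> Y" "v \<in> X <+> Y" "map_sum g h u = map_sum g h v"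
  thus "u = v" using inj_onD[OF assms(1)] inj_onD[OF assms(2)] by (cases u; cases v) auto
qed

text \<open>Only the copies of \<open>complete_bipartite p p\<close> with left part \<open>X\<close>
  and right part \<open>Y\<close> are used.\<close>

lemma few_repeats_complete_bipartite:
  fixes c :: "(nat + nat) set \<Rightarrow> 'c"
  assumes "Hq_coloring (complete_bipartite n n) (complete_bipartite p p) (p\<^sup>2 - p + 1) c" "p \<le> n"
  shows "few_repeats p n (\<lambda>i j. c {Inl i, Inr j})"
proof (rule few_repeatsI[OF assms(2)])
  fix X Y assume X: "X \<subseteq> {..<n}" "card X = p" and Y: "Y \<subseteq> {..<n}" "card Y = p"
  define S :: "(nat + nat) graph" where
    "S = \<lparr>verts = X <+> Y, edges = (\<lambda>(i, j). {Inl i, Inr j}) ` (X \<times> Y)\<rparr>"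
  have "finite X" "finite Y" using X Y by (auto intro: finite_subset)
  then obtain g h where g: "bij_betw g X {..<p}" and h: "bij_betw h Y {..<p}"
    using X Y ex_bij_betw_finite_nat by (metis atLeast0LessThan)
  have "subgraph S (complete_bipartite n n)"
    using X Y by (fastforce simp: subgraph_def simple_graph_def S_def complete_bipartite_def)
  moreover have "graph_iso S (complete_bipartite p p)"
    unfolding graph_iso_def
  proof (intro exI conjI)
    have im: "g ` X = {..<p}" "h ` Y = {..<p}" using g h by (simp_all add: bij_betw_def)
    have "map_sum g h ` (X <+> Y) = g ` X <+> h ` Y"
      by (simp add: Plus_def image_Un image_image)
    moreover have "inj_on (map_sum g h) (X <+> Y)"
      using g h by (intro inj_on_map_sum_Plus bij_betw_imp_inj_on)
    ultimately show "bij_betw (map_sum g h) (verts S) (verts (complete_bipartite p p))"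
      by (simp add: bij_betw_def S_def complete_bipartite_def im)
    have "(\<lambda>e. map_sum g h ` e) ` edges S = (\<lambda>(i, j). {Inl i, Inr j}) ` map_prod g h ` (X \<times> Y)"
      by (simp add: S_def image_image case_prod_unfold)
    also have "map_prod g h ` (X \<times> Y) = {..<p} \<times> {..<p}"
      using im by (rule map_prod_surj_on)
    also have "(\<lambda>(i, j). {Inl i, Inr j}) ` \<dots> = edges (complete_bipartite p p)"
      by (rule edges_complete_bipartite[symmetric])
    finally show "(\<lambda>e. map_sum g h ` e) ` edges S = edges (complete_bipartite p p)" .
  qed
  ultimately have "p\<^sup>2 - p + 1 \<le> card (c ` edges S)"
    using assms(1) by (simp add: Hq_coloring_def)
  also have "c ` edges S = (\<lambda>(i, j). c {Inl i, Inr j}) ` (X \<times> Y)"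
    by (simp add: S_def image_image case_prod_unfold)
  finally show "p\<^sup>2 - p + 1 \<le> card ((\<lambda>(i, j). c {Inl i, Inr j}) ` (X \<times> Y))" .
qed

lemma card_edges_complete_bipartite: "card (edges (complete_bipartite m n)) = m * n"
proof -
  have "inj_on (\<lambda>(i, j). {Inl i, Inr j}) ({..<m} \<times> {..<n})"
    by (auto simp: inj_on_def doubleton_eq_iff)
  thus ?thesis by (simp add: edges_complete_bipartite card_image card_cartesian_product)
qed

lemma gen_ramsey_few_repeats:
  assumes "1 \<le> p" "p \<le> n"
  obtains f :: "nat \<Rightarrow> nat \<Rightarrow> nat" where "few_repeats p n f"
    "card (case_prod f ` ({..<n} \<times> {..<n})) =
       gen_ramsey (complete_bipartite n n) (complete_bipartite p p) (p\<^sup>2 - p + 1)"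
proof -
  have "finite (edges (complete_bipartite n n))" by (simp add: edges_complete_bipartite)
  moreover have "p\<^sup>2 - p + 1 \<le> card (edges (complete_bipartite p p))"
    using assms(1) by (cases p) (simp_all add: card_edges_complete_bipartite power2_eq_square)
  ultimately obtain c :: "(nat + nat) set \<Rightarrow> nat" where
    c: "Hq_coloring (complete_bipartite n n) (complete_bipartite p p) (p\<^sup>2 - p + 1) c"
      "card (c ` edges (complete_bipartite n n)) =
         gen_ramsey (complete_bipartite n n) (complete_bipartite p p) (p\<^sup>2 - p + 1)"
    using gen_ramsey_attained by blast
  moreover have "c ` edges (complete_bipartite n n) =
      (\<lambda>(i, j). c {Inl i, Inr j}) ` ({..<n} \<times> {..<n})"
    by (simp add: edges_complete_bipartite image_image case_prod_unfold)
  ultimately show ?thesis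
    using that[OF few_repeats_complete_bipartite[OF c(1) assms(2)]] by simp
qed

text \<open>Choosing \<open>b\<close> just above the \<open>t\<close>-th root of
  \<open>2 * n\<^sup>2\<close> makes it of order \<open>n powr (2 / t)\<close>, and
  \<open>colors_lower_bound\<close> then bounds \<open>n\<^sup>2\<close> by a constant times
  \<open>r * b\<close>.\<close>

lemma gen_ramsey_lower_bound:
  fixes p n :: nat
  defines "t \<equiv> p div 2"
    and "r \<equiv> gen_ramsey (complete_bipartite n n) (complete_bipartite p p) (p\<^sup>2 - p + 1)"
  assumes p: "4 \<le> p" and n: "p \<le> n"
  shows "real n powr (2 - 2 / real t) \<le> 1024 * real t * (real p)\<^sup>2 * real r"
proof -
  obtain f :: "nat \<Rightarrow> nat \<Rightarrow> nat" where f: "few_repeats p n f"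
    "card (case_prod f ` ({..<n} \<times> {..<n})) = r"
    using gen_ramsey_few_repeats[of p n] p n unfolding r_def by auto
  have t: "1 \<le> t" using p by (auto simp: t_def)
  have n0: "real n > 0" using p n by simp
  define s where "s = (2 * (real n)\<^sup>2) powr (1 / real t)"
  \<comment> \<open>The least integer strictly above \<open>s\<close>; since \<open>s\<close> is at
    least 1, it is at most \<open>2 * s\<close>.\<close>
  define b where "b = nat \<lfloor>s\<rfloor> + 1"
  have "1 \<le> real n * real n" using n0 p n by (intro mult_ge1_I) auto
  hence "1 \<le> 2 * (real n)\<^sup>2" unfolding power2_eq_square by linarith
  hence s1: "1 \<le> s" unfolding s_def by (intro ge_one_powr_ge_zero) auto
  have bs: "s < real b" "real b \<le> 2 * s" using s1 by (auto simp: b_def) linarith+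
  have "s = 2 powr (1 / real t) * ((real n)\<^sup>2) powr (1 / real t)"
    by (simp add: s_def powr_mult)
  also have "((real n)\<^sup>2) powr (1 / real t) = real n powr (2 / real t)"
    using n0 by (simp add: powr_powr flip: powr_numeral)
  also have "(2::real) powr (1 / real t) \<le> 2 powr 1"
    using t by (intro powr_mono) auto
  finally have s2: "s \<le> 2 * real n powr (2 / real t)" by (simp add: mult_right_mono)
  have "s ^ t = s powr real t" using s1 by (simp add: powr_realpow)
  also have "\<dots> = 2 * (real n)\<^sup>2" using t n0 by (simp add: s_def powr_powr)
  finally have "2 * (real n)\<^sup>2 = s ^ t" ..
  also have "\<dots> < real b ^ t" using bs s1 t by (intro power_strict_mono) auto
  finally have "real (2 * n\<^sup>2) < real (b ^ t)" by simp
  hence "2 * n\<^sup>2 < b ^ t" by (simp only: of_nat_less_iff)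
  hence "n\<^sup>2 \<le> 128 * r * (t * p\<^sup>2 + t * b)"
    using colors_lower_bound[OF f(1) p] f(2) p n by (simp add: t_def)
  \<comment> \<open>A crude estimate that turns the sum into a multiple of \<open>b\<close>, as both
    \<open>p\<^sup>2\<close> and \<open>b\<close> are at least 1.\<close>
  also have "\<dots> \<le> 128 * r * (t * (p\<^sup>2 * b) + t * (p\<^sup>2 * b))"
  proof -
    have "1 \<le> p\<^sup>2" "1 \<le> b" using p by (simp_all add: b_def)
    thus ?thesis
      using mult_le_mono2[of 1 b "p\<^sup>2"] mult_le_mono1[of 1 "p\<^sup>2" b]
      by (intro mult_le_mono add_mono order.refl) simp_all
  qed
  finally have "real (n\<^sup>2) \<le> real (128 * r * (t * (p\<^sup>2 * b) + t * (p\<^sup>2 * b)))"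
    by (rule of_nat_mono)
  hence "(real n)\<^sup>2 \<le> 256 * real r * real t * (real p)\<^sup>2 * real b" by (simp add: algebra_simps)
  also have "\<dots> \<le> 256 * real r * real t * (real p)\<^sup>2 * (4 * real n powr (2 / real t))"
    using bs s2 by (intro mult_left_mono) auto
  finally have "(real n)\<^sup>2 / real n powr (2 / real t) \<le> 1024 * real t * (real p)\<^sup>2 * real r"
    using n0 by (simp add: divide_le_eq mult_ac)
  thus ?thesis using n0 by (simp add: powr_diff)
qed

theorem theorem1p6:
  fixes p :: nat
  assumes "p \<ge> 2"
  shows "(\<lambda>n::nat. real (gen_ramsey (complete_bipartite n n) (complete_bipartite p p) (p\<^sup>2 - p + 1)))
           \<in> \<Omega>(\<lambda>n. real n powr (2 - 2 / real (p div 2)))"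
proof (cases "p < 4")
  case True
  \<comment> \<open>The exponent is 0 here, so it suffices that at least one color is used.\<close>
  hence t: "p div 2 = 1" using assms by simp
  have "1 \<le> gen_ramsey (complete_bipartite n n) (complete_bipartite p p) (p\<^sup>2 - p + 1)"
    if n: "p \<le> n" for n
  proof -
    obtain f :: "nat \<Rightarrow> nat \<Rightarrow> nat" where f: "card (case_prod f ` ({..<n} \<times> {..<n})) =
        gen_ramsey (complete_bipartite n n) (complete_bipartite p p) (p\<^sup>2 - p + 1)"
      using gen_ramsey_few_repeats[of p n] assms n by auto
    have "case_prod f ` ({..<n} \<times> {..<n}) \<noteq> {}" using n assms by (auto simp: lessThan_empty_iff)
    hence "card (case_prod f ` ({..<n} \<times> {..<n})) \<noteq> 0" by simp
    thus ?thesis using f by simp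
  qed
  hence "eventually (\<lambda>n. 1 \<le> gen_ramsey (complete_bipartite n n) (complete_bipartite p p)
      (p\<^sup>2 - p + 1)) sequentially"
    unfolding eventually_sequentially by blast
  thus ?thesis
    by (intro landau_omega.bigI[of 1]) (auto elim!: eventually_mono simp: t)
next
  case False
  let ?C = "1024 * real (p div 2) * (real p)\<^sup>2"
  have C: "0 < ?C" using False by simp
  have "eventually (\<lambda>n. real n powr (2 - 2 / real (p div 2)) \<le>
      ?C * real (gen_ramsey (complete_bipartite n n) (complete_bipartite p p) (p\<^sup>2 - p + 1))) sequentially"
    unfolding eventually_sequentially using gen_ramsey_lower_bound[of p] False by auto
  thus ?thesis
    using C by (intro landau_omega.bigI[of "1 / ?C"])
      (auto elim!: eventually_mono simp: divide_le_eq mult_ac)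
qed

end
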